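(* Let $\alpha>-1$ be real. For every integer $n\ge 0$, the $(n+1)\times(n+1)$ matrix $$\left((\alpha+1)_{i+j}\right)_{0\le i,j\le n}$$ has determinant $$\det\left((\alpha+1)_{i+j}\right)_{i,j=0}^{n}=\frac{G(n+2)\,G(\alpha+n+2)}{G(\alpha+1)\,\Gamma(\alpha+1)^{n+1}},$$ and its inverse is $$\left(\frac{\sum_{k=\max(i,j)}^{n}\frac{(\alpha+1)_{k}}{k!}\binom{k}{i}\binom{k}{j}}{(-1)^{i+j}(\alpha+1)_{i}(\alpha+1)_{j}}\right)_{0\le i,j\le n}.$$
   Context: $\Gamma$ is Euler's gamma function and $(a)_n=\Gamma(a+n)/\Gamma(a)$ is the shifted factorial. $G$ is the Barnes $G$-function, the entire function given by $G(z+1)=(2\pi)^{z/2}e^{-[z(z+1)+\gamma z^2]/2}\prod_{m=1}^{\infty}\left(1+\frac zm\right)^m e^{-z+z^2/(2m)}$ with $\gamma$ Euler's constant; it satisfies $G(z+1)=\Gamma(z)G(z)$, $G(1)=1$, and hence $\prod_{k=0}^{n}\Gamma(z+k)=G(z+n+1)/G(z)$. *)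

theory Defs
  imports
    "HOL-Analysis.Gamma_Function"
    "HOL-Analysis.Infinite_Products"
    "Jordan_Normal_Form.Determinant"
begin

(* The usual Weierstrass product, which is a formula for G (z + 1), evaluated at z = s - 1.
   The factor with index m >= 1 of the product is the one with index Suc k = m here.
   prodinf allows for vanishing factors, so the zeros of G at 0, -1, -2, ... are covered. *)
definition barnes_G :: "complex \<Rightarrow> complex" where
  "barnes_G s =
     (let z = s - 1 in
        of_real (2 * pi) powr (z / 2)
        * exp (- (z * (z + 1) + of_real euler_mascheroni * z\<^sup>2) / 2)
        * (\<Prod>k. (1 + z / of_nat (Suc k)) ^ Suc k * exp (- z + z\<^sup>2 / (2 * of_nat (Suc k)))))"

definition moment_mat :: "real \<Rightarrow> nat \<Rightarrow> real mat" where
  "moment_mat \<alpha> n = Matrix.mat (n + 1) (n + 1) (\<lambda>(i, j). pochhammer (\<alpha> + 1) (i + j))"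

definition moment_inv_mat :: "real \<Rightarrow> nat \<Rightarrow> real mat" where
  "moment_inv_mat \<alpha> n = Matrix.mat (n + 1) (n + 1) (\<lambda>(i, j).
     (\<Sum>k = max i j..n. pochhammer (\<alpha> + 1) k / fact k * of_nat (k choose i) * of_nat (k choose j))
     / ((- 1) ^ (i + j) * pochhammer (\<alpha> + 1) i * pochhammer (\<alpha> + 1) j))"

end

theory Submission
  imports Defs "HOL-Real_Asymp.Real_Asymp"
begin

text \<open>
  Write \<open>a = \<alpha> + 1\<close>. The Chu-Vandermonde identity reads
  \<open>(a)\<^bsub>i+j\<^esub> = (\<Sum>k. (a)\<^sub>i (i choose k) \<cdot> k! / (a)\<^sub>k \<cdot> (a)\<^sub>j (j choose k))\<close>,
  which is a factorization of the matrix as \<open>L D L\<^sup>T\<close> with \<open>L\<close> lower triangular and \<open>D\<close> diagonal.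
  The determinant is therefore \<open>\<Prod>k\<le>n. k! (a)\<^sub>k\<close>, and since \<open>L\<close> is inverted by binomial inversion,
  the inverse matrix is \<open>L\<^sup>-\<^sup>T D\<^sup>-\<^sup>1 L\<^sup>-\<^sup>1\<close>.

  To express the determinant through the Barnes function one needs \<open>G (s + 1) = \<Gamma> s G s\<close> for the
  Weierstrass product. The quotient of the partial products at \<open>s\<close> and \<open>s - 1\<close> telescopes;
  its limit follows from Euler's limit formula for \<open>\<Gamma>\<close>, the definition of
  Euler's constant, and Stirling's formula, which supplies the factor \<open>sqrt (2 \<pi>)\<close>.
\<close>

subsection \<open>Factorization of the moment matrix\<close>

lemma pochhammer_minus_of_nat:
  "pochhammer (- of_nat n) k = (- 1) ^ k * fact k * (of_nat (n choose k) :: 'a::field_char_0)"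
  by (simp add: binomial_gbinomial gbinomial_pochhammer)

text \<open>The terms are those of the terminating series 2F1(-i, -j; a; 1), which Chu-Vandermonde
  sums to (a + i)_j / (a)_j. The upper limit may be any n >= j because \<open>j choose k\<close>
  vanishes beyond j.\<close>

lemma pochhammer_connection:
  fixes a :: "'a::field_char_0"
  assumes a: "\<And>m. a \<noteq> - of_nat m" and "j \<le> n"
  shows "(\<Sum>k\<le>n. pochhammer a i * of_nat (i choose k) * (fact k / pochhammer a k)
            * (pochhammer a j * of_nat (j choose k))) = pochhammer a (i + j)"
proof -
  have nz: "pochhammer a k \<noteq> 0" for k
    using a by (auto simp: pochhammer_eq_0_iff)
  \<comment> \<open>The two negative upper parameters each contribute a sign (-1)^k; these
    cancel.\<close>
  have sq: "(-1) ^ k * ((-1) ^ k * x) = (x :: 'a)" for k x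
    by (simp flip: mult.assoc power_add)
  have "(\<Sum>k\<le>n. pochhammer a i * of_nat (i choose k) * (fact k / pochhammer a k)
            * (pochhammer a j * of_nat (j choose k)))
      = (\<Sum>k\<le>j. pochhammer a i * of_nat (i choose k) * (fact k / pochhammer a k)
            * (pochhammer a j * of_nat (j choose k)))"
    using assms(2) by (intro sum.mono_neutral_right) (auto simp: binomial_eq_0)
  also have "\<dots> = pochhammer a i * pochhammer a j *
     (\<Sum>k=0..j. pochhammer (- of_nat i) k * pochhammer (- of_nat j) k
                / (of_nat (fact k) * pochhammer a k))"
    unfolding sum_distrib_left atMost_atLeast0
    by (intro sum.cong refl) (simp add: pochhammer_minus_of_nat sq mult_ac)
  also have "\<dots> = pochhammer a i * pochhammer (a + of_nat i) j"
    using a nz by (subst Vandermonde_pochhammer) auto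
  also have "\<dots> = pochhammer a (i + j)"
    by (simp add: pochhammer_product')
  finally show ?thesis .
qed

text \<open>Since (i choose k)(k choose j) = (i choose j)(i-j choose k-j), what remains is an
  alternating row sum of Pascal's triangle, which vanishes unless i = j.\<close>

lemma binomial_inversion_sum:
  assumes "i \<le> n"
  shows "(\<Sum>k\<le>n. (- 1) ^ (k + j) * of_nat (i choose k) * of_nat (k choose j))
           = (if i = j then 1 else 0 :: 'a::comm_ring_1)"
proof (cases "j \<le> i")
  case False
  then have "of_nat (i choose k) * of_nat (k choose j) = (0 :: 'a)" for k
    by (cases "k < j") (auto simp: binomial_eq_0)
  then show ?thesis
    using False by (simp add: mult.assoc)
next
  case True
  have "(\<Sum>k\<le>n. (- 1) ^ (k + j) * of_nat (i choose k) * of_nat (k choose j))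
      = (\<Sum>k\<in>{j..i}. (- 1) ^ (k + j) * of_nat (i choose k) * of_nat (k choose j) :: 'a)"
    using assms by (intro sum.mono_neutral_right) (auto simp: binomial_eq_0 not_le)
  also have "\<dots> = (\<Sum>l\<le>i-j. (- 1) ^ (l + j + j) * of_nat (i choose (l + j)) * of_nat ((l + j) choose j))"
    using True by (intro sum.reindex_bij_witness[of _ "\<lambda>l. l + j" "\<lambda>k. k - j"]) auto
  also have "\<dots> = (\<Sum>l\<le>i-j. of_nat (i choose j) * ((- 1) ^ l * of_nat ((i - j) choose l)))"
  proof (intro sum.cong refl)
    fix l assume "l \<in> {..i-j}"
    then have "(i choose (l + j)) * ((l + j) choose j) = (i choose j) * ((i - j) choose l)"
      using True choose_mult[of j "l + j" i] by auto
    then have "of_nat (i choose (l + j)) * of_nat ((l + j) choose j)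
       = (of_nat (i choose j) * of_nat ((i - j) choose l) :: 'a)"
      by (metis of_nat_mult)
    then show "(- 1) ^ (l + j + j) * of_nat (i choose (l + j)) * of_nat ((l + j) choose j)
       = of_nat (i choose j) * ((- 1) ^ l * of_nat ((i - j) choose l) :: 'a)"
      by (simp add: power_add mult_ac flip: power_mult_distrib)
  qed
  also have "\<dots> = of_nat (i choose j) * (\<Sum>l\<le>i-j. (- 1) ^ l * of_nat ((i - j) choose l))"
    by (simp add: sum_distrib_left)
  also have "\<dots> = (if i = j then 1 else 0)"
    using True choose_alternating_sum[of "i - j", where 'a = 'a] by auto
  finally show ?thesis .
qed

section \<open>Triangular factors, determinant and inverse of the moment matrix\<close>

definition binomial_factor :: "real \<Rightarrow> nat \<Rightarrow> real mat" where
  "binomial_factor a n = Matrix.mat (n + 1) (n + 1)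
     (\<lambda>(i, k). pochhammer a i * of_nat (i choose k))"

definition binomial_factor_inv :: "real \<Rightarrow> nat \<Rightarrow> real mat" where
  "binomial_factor_inv a n = Matrix.mat (n + 1) (n + 1)
     (\<lambda>(k, i). (- 1) ^ (k + i) * of_nat (k choose i) / pochhammer a i)"

lemma binomial_factor_carrier [simp]:
  "binomial_factor a n \<in> carrier_mat (n + 1) (n + 1)"
  "binomial_factor_inv a n \<in> carrier_mat (n + 1) (n + 1)"
  by (auto simp: binomial_factor_def binomial_factor_inv_def)

text \<open>The row and column scalings contribute only a constant (a)_i / (a)_j to binomial
  inversion, and it is 1 on the diagonal. For square matrices the one-sided inverse is
  two-sided.\<close>

lemma binomial_factor_inverse:
  assumes "a > 0"
  shows "binomial_factor a n * binomial_factor_inv a n = 1\<^sub>m (n + 1)"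
    and "binomial_factor_inv a n * binomial_factor a n = 1\<^sub>m (n + 1)"
proof -
  show *: "binomial_factor a n * binomial_factor_inv a n = 1\<^sub>m (n + 1)"
  proof (rule eq_matI)
    fix i j assume "i < dim_row (1\<^sub>m (n + 1) :: real mat)" "j < dim_col (1\<^sub>m (n + 1) :: real mat)"
    then have ij: "i \<le> n" "j \<le> n" by auto
    have "(binomial_factor a n * binomial_factor_inv a n) $$ (i, j)
        = (\<Sum>k = 0..<n + 1. pochhammer a i * of_nat (i choose k)
             * ((- 1) ^ (k + j) * of_nat (k choose j) / pochhammer a j))"
      using ij by (simp add: binomial_factor_def binomial_factor_inv_def scalar_prod_def)
    also have "\<dots> = (\<Sum>k\<le>n. pochhammer a i / pochhammer a j *
             ((- 1) ^ (k + j) * of_nat (i choose k) * of_nat (k choose j)))"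
      by (intro sum.cong) (auto simp: field_simps)
    also have "\<dots> = pochhammer a i / pochhammer a j * (if i = j then 1 else 0)"
      by (simp only: sum_distrib_left [symmetric] binomial_inversion_sum[OF ij(1)])
    also have "\<dots> = 1\<^sub>m (n + 1) $$ (i, j)"
      using ij pochhammer_pos[OF assms, of j] by auto
    finally show "(binomial_factor a n * binomial_factor_inv a n) $$ (i, j) = 1\<^sub>m (n + 1) $$ (i, j)" .
  qed (auto simp: binomial_factor_def binomial_factor_inv_def)
  show "binomial_factor_inv a n * binomial_factor a n = 1\<^sub>m (n + 1)"
    by (rule mat_mult_left_right_inverse[OF binomial_factor_carrier *])
qed

lemma moment_mat_factorization:
  assumes "\<alpha> > -1"
  shows "moment_mat \<alpha> n = binomial_factor (\<alpha> + 1) n *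
    (mat_diag (n + 1) (\<lambda>k. fact k / pochhammer (\<alpha> + 1) k) * (binomial_factor (\<alpha> + 1) n)\<^sup>T)"
proof (rule eq_matI, goal_cases)
  case (1 i j)
  then have ij: "i \<le> n" "j \<le> n"
    by (auto simp: binomial_factor_def)
  have "\<alpha> + 1 \<noteq> - of_nat m" for m
    using assms by auto
  from pochhammer_connection[OF this ij(2), of i] show ?case
    using ij by (subst mat_diag_mult_left[of _ _ "n + 1"])
      (auto simp: moment_mat_def binomial_factor_def scalar_prod_def atLeast0LessThan
         lessThan_Suc_atMost mult_ac simp del: sum.op_ivl_Suc sum.lessThan_Suc)
qed (auto simp: moment_mat_def binomial_factor_def)

text \<open>Terms with k < max i j vanish through the binomials, so the sum over k may start at 0
  and becomes an entry of the matrix product.\<close>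

lemma moment_inv_mat_factorization:
  assumes "\<alpha> > -1"
  shows "moment_inv_mat \<alpha> n = (binomial_factor_inv (\<alpha> + 1) n)\<^sup>T *
    (mat_diag (n + 1) (\<lambda>k. pochhammer (\<alpha> + 1) k / fact k) * binomial_factor_inv (\<alpha> + 1) n)"
proof (rule eq_matI, goal_cases)
  case (1 i j)
  then have ij: "i \<le> n" "j \<le> n"
    by (auto simp: binomial_factor_inv_def)
  let ?t = "\<lambda>k. pochhammer (\<alpha> + 1) k / fact k * of_nat (k choose i) * of_nat (k choose j)"
  \<comment> \<open>The sign does not depend on k and is its own inverse, so it can stand in the
    denominator as in \<open>moment_inv_mat\<close>.\<close>
  have sgn: "(- 1) ^ (k + i) * (- 1) ^ (k + j) = inverse ((- 1 :: real) ^ (i + j))" for k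
    by (simp add: power_add mult_ac flip: power_mult_distrib power_inverse)
  have "moment_inv_mat \<alpha> n $$ (i, j)
     = (\<Sum>k = max i j..n. ?t k) / ((- 1) ^ (i + j) * pochhammer (\<alpha> + 1) i * pochhammer (\<alpha> + 1) j)"
    using ij by (simp add: moment_inv_mat_def)
  also have "(\<Sum>k = max i j..n. ?t k) = (\<Sum>k = 0..<n + 1. ?t k)"
    by (intro sum.mono_neutral_left) (auto simp: binomial_eq_0)
  also have "\<dots> / ((- 1) ^ (i + j) * pochhammer (\<alpha> + 1) i * pochhammer (\<alpha> + 1) j)
     = (\<Sum>k = 0..<n + 1. (- 1) ^ (k + i) * (- 1) ^ (k + j) * ?t k
          / (pochhammer (\<alpha> + 1) i * pochhammer (\<alpha> + 1) j))"
    unfolding sgn sum_divide_distrib by (intro sum.cong refl) (simp add: divide_simps)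
  finally show ?case
    using ij by (subst mat_diag_mult_left[of _ _ "n + 1"])
      (auto simp: binomial_factor_inv_def scalar_prod_def mult_ac intro!: sum.cong)
qed (auto simp: moment_inv_mat_def binomial_factor_inv_def)

text \<open>The product of the two factorizations collapses from the inside out: first
  \<open>L\<^sup>T * U\<^sup>T\<close>, then \<open>D * E\<close>, then
  \<open>L * U\<close>.\<close>

lemma moment_mat_mult_inv:
  assumes "\<alpha> > -1"
  shows "moment_mat \<alpha> n * moment_inv_mat \<alpha> n = 1\<^sub>m (n + 1)"
proof -
  define L where "L = binomial_factor (\<alpha> + 1) n"
  define U where "U = binomial_factor_inv (\<alpha> + 1) n"
  define D where "D = mat_diag (n + 1) (\<lambda>k. fact k / pochhammer (\<alpha> + 1) k)"
  define E where "E = mat_diag (n + 1) (\<lambda>k. pochhammer (\<alpha> + 1) k / fact k)"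
  have carr: "L \<in> carrier_mat (n+1) (n+1)" "U \<in> carrier_mat (n+1) (n+1)"
    "D \<in> carrier_mat (n+1) (n+1)" "E \<in> carrier_mat (n+1) (n+1)"
    "L\<^sup>T \<in> carrier_mat (n+1) (n+1)" "U\<^sup>T \<in> carrier_mat (n+1) (n+1)"
    unfolding L_def U_def D_def E_def by (simp_all del: add_Suc_right One_nat_def)
  have pos: "\<alpha> + 1 > 0"
    using assms by simp
  have LU: "L * U = 1\<^sub>m (n + 1)" "U * L = 1\<^sub>m (n + 1)"
    unfolding L_def U_def using binomial_factor_inverse[OF pos] by auto
  have DE: "D * E = 1\<^sub>m (n + 1)"
    using pochhammer_pos[OF pos] unfolding D_def E_def mat_diag_diag
    by (simp add: less_imp_neq[symmetric])
  \<comment> \<open>Transposition reverses products, so this uses \<open>U * L\<close>, not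
    \<open>L * U\<close>.\<close>
  have "L\<^sup>T * U\<^sup>T = (U * L)\<^sup>T"
    using carr by (simp add: transpose_mult)
  then have LU': "L\<^sup>T * U\<^sup>T = 1\<^sub>m (n + 1)"
    using LU by simp
  have "moment_mat \<alpha> n * moment_inv_mat \<alpha> n = (L * (D * L\<^sup>T)) * (U\<^sup>T * (E * U))"
    unfolding L_def U_def D_def E_def
    using moment_mat_factorization moment_inv_mat_factorization assms by simp
  also have "\<dots> = L * (D * ((L\<^sup>T * U\<^sup>T) * (E * U)))"
    using carr by (simp add: assoc_mult_mat[of _ "n+1" "n+1" _ "n+1" _ "n+1"] del: One_nat_def add_Suc_right)
  also have "\<dots> = L * ((D * E) * U)"
    unfolding LU' using carr
    by (simp add: assoc_mult_mat[of _ "n+1" "n+1" _ "n+1" _ "n+1"] left_mult_one_mat[of _ "n+1" "n+1"]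
         del: One_nat_def add_Suc_right)
  also have "\<dots> = 1\<^sub>m (n + 1)"
    unfolding DE using carr LU by (simp add: left_mult_one_mat[of _ "n+1" "n+1"] del: One_nat_def add_Suc_right)
  finally show ?thesis .
qed

text \<open>The triangular factor has diagonal entries (a)_k with a = \<alpha> + 1 and occurs twice;
  the diagonal factor k! / (a)_k takes one of the two powers of (a)_k away.\<close>

lemma det_moment_mat:
  assumes "\<alpha> > -1"
  shows "Determinant.det (moment_mat \<alpha> n) = (\<Prod>k\<le>n. fact k * pochhammer (\<alpha> + 1) k)"
proof -
  have pos: "\<alpha> + 1 > 0"
    using assms by simp
  let ?L = "binomial_factor (\<alpha> + 1) n"
  let ?D = "mat_diag (n + 1) (\<lambda>k. fact k / pochhammer (\<alpha> + 1) k)"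
  have prod: "prod_list (diag_mat A) = (\<Prod>k\<le>n. A $$ (k, k))" if "A \<in> carrier_mat (n + 1) (n + 1)"
    for A :: "real mat"
    using that by (simp add: prod_list_diag_prod atLeast0LessThan lessThan_Suc_atMost)
  have L: "Determinant.det ?L = (\<Prod>k\<le>n. pochhammer (\<alpha> + 1) k)"
    by (subst det_lower_triangular[of "n + 1"], simp add: binomial_factor_def,
        simp del: One_nat_def add_Suc_right, subst prod)
       (auto simp: binomial_factor_def intro!: prod.cong)
  have D: "Determinant.det ?D = (\<Prod>k\<le>n. fact k / pochhammer (\<alpha> + 1) k)"
    by (subst det_lower_triangular[of "n + 1"], simp add: mat_diag_def,
        simp del: One_nat_def add_Suc_right, subst prod)
       (auto simp: mat_diag_def intro!: prod.cong)
  have "Determinant.det (moment_mat \<alpha> n) = Determinant.det ?L * (Determinant.det ?D * Determinant.det ?L)"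
    using binomial_factor_carrier(1)[of "\<alpha> + 1" n] mat_diag_dim[of "n + 1"]
    by (simp add: moment_mat_factorization[OF assms] det_mult[of _ "n + 1"] det_transpose[of _ "n + 1"]
             mult_carrier_mat[of _ "n + 1" "n + 1"] del: One_nat_def add_Suc_right)
  also have "\<dots> = (\<Prod>k\<le>n. pochhammer (\<alpha> + 1) k * (fact k / pochhammer (\<alpha> + 1) k * pochhammer (\<alpha> + 1) k))"
    unfolding L D by (simp only: prod.distrib)
  also have "\<dots> = (\<Prod>k\<le>n. fact k * pochhammer (\<alpha> + 1) k)"
    using pochhammer_pos[OF pos] by (intro prod.cong refl) (simp add: less_imp_neq[symmetric])
  finally show ?thesis .
qed

subsection \<open>The functional equation of the Barnes function\<close>

text \<open>The logarithm of n! / (n^(n+1/2) e^(-n)) has summable increments, hence a limit. The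
  constant is then identified from Gamma(1/2) = sqrt(pi).\<close>

lemma stirling:
  "(\<lambda>n. fact n / (sqrt (2 * pi * real n) * (real n / exp 1) ^ n)) \<longlonglongrightarrow> 1"
proof -
  define L where "L n = ln (fact n) - (real n + 1/2) * ln (real n) + real n" for n
  \<comment> \<open>This is the increment of \<open>L\<close>; the shift by 1/2 cancels the 1/n term
    of its expansion.\<close>
  have "(\<lambda>n. 1 - (real n + 1/2) * (ln (real n + 1) - ln (real n))) \<in> O(\<lambda>n. 1 / real n ^ 2)"
    by real_asymp
  moreover have "eventually (\<lambda>n. 1 - (real n + 1/2) * (ln (real n + 1) - ln (real n))
                   = L (Suc n) - L n) sequentially"
    using eventually_gt_at_top[of 0]
  proof eventually_elim
    case (elim n)
    have "ln (fact (Suc n)) = ln (real n + 1) + ln (fact n :: real)"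
      by (simp add: ln_mult add.commute)
    then show ?case
      by (simp add: L_def algebra_simps)
  qed
  ultimately have "(\<lambda>n. L (Suc n) - L n) \<in> O(\<lambda>n. 1 / real n ^ 2)"
    by (rule iffD1[OF landau_o.big.in_cong, rotated])
  moreover have "summable (\<lambda>n. norm (1 / real n ^ 2))"
    using inverse_power_summable[of 2, where 'a = real] by (simp add: inverse_eq_divide)
  ultimately have "summable (\<lambda>n. L (Suc n) - L n)"
    by (rule summable_comparison_test_bigo[rotated])
  then have "(\<lambda>n. \<Sum>k<n. L (Suc k) - L k) \<longlonglongrightarrow> (\<Sum>k. L (Suc k) - L k)"
    by (rule summable_LIMSEQ)
  \<comment> \<open>The telescoped sum is \<open>L n - L 0\<close>, and \<open>L 0 = 0\<close> by
    the convention \<open>ln 0 = 0\<close>.\<close>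
  moreover have "(\<Sum>k<n. L (Suc k) - L k) = L n" for n
    by (simp add: sum_lessThan_telescope) (simp add: L_def)
  ultimately have "L \<longlonglongrightarrow> (\<Sum>k. L (Suc k) - L k)"
    by simp
  then obtain c where "L \<longlonglongrightarrow> c" ..
  define K where "K = exp c"
  define a where "a n = exp (L n)" for n
  have K: "K > 0" and aK: "a \<longlonglongrightarrow> K"
    unfolding K_def a_def using \<open>L \<longlonglongrightarrow> c\<close> by (auto intro: tendsto_intros)
  have a_eq: "a n = fact n / (sqrt (real n) * (real n / exp 1) ^ n)" if "n > 0" for n
  proof -
    have "L n = ln (fact n) - (ln (sqrt (real n)) + real n * (ln (real n) - 1))"
      using that by (simp add: L_def ln_sqrt algebra_simps)
    moreover have "real n * (ln (real n) - 1) = ln ((real n / exp 1) ^ n)"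
      using that by (simp add: ln_realpow ln_div)
    ultimately have "L n = ln (fact n / (sqrt (real n) * (real n / exp 1) ^ n))"
      using that by (simp add: ln_mult ln_div)
    then show ?thesis
      using that by (simp add: a_def)
  qed
  \<comment> \<open>This ratio tends to K, while the duplication formula for (2n)! turns it into
    Euler's sequence for Gamma(1/2) times sqrt 2; hence K = sqrt(2 pi).\<close>
  have "(\<lambda>n. a n ^ 2 / a (2 * n)) \<longlonglongrightarrow> K ^ 2 / K"
    using K aK by (intro tendsto_intros filterlim_compose[OF aK] filterlim_subseq)
      (auto simp: strict_mono_def)
  moreover have "(\<lambda>n. sqrt 2 * Gamma_series' (1/2) n) \<longlonglongrightarrow> sqrt 2 * sqrt pi"
    by (intro tendsto_intros Gamma_series'_LIMSEQ[of "1/2 :: real", unfolded Gamma_one_half_real])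
  moreover have "eventually (\<lambda>n. a n ^ 2 / a (2 * n) = sqrt 2 * Gamma_series' (1/2) n) sequentially"
    using eventually_gt_at_top[of 0]
  proof eventually_elim
    case (elim n)
    have sq: "sqrt (real n) ^ 2 = real n" by simp
    have p: "(fact (2 * n) :: real) = 4 ^ n * pochhammer (1/2) n * fact n"
      using fact_double[of n, where 'a = real] by (simp add: power_mult)
    have pp: "pochhammer (1/2 :: real) n > 0"
      by (rule pochhammer_pos) simp
    have f: "(fact n :: real) = real n * fact (n - 1)"
      using elim by (simp add: fact_reduce)
    have e: "exp (1/2 * ln (real n)) = sqrt (real n)"
      using elim by (simp add: powr_half_sqrt[symmetric] powr_def)
    have "a n ^ 2 / a (2 * n) = fact n ^ 2 * (sqrt 2 * sqrt (real n) * (2 * real n / exp 1) ^ (2 * n))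
        / (real n * (real n / exp 1) ^ (2 * n) * fact (2 * n))"
      using elim by (simp add: a_eq real_sqrt_mult power_mult_distrib power_divide
          power_mult[symmetric] mult.commute[of n 2])
    also have "(2 * real n / exp 1) ^ (2 * n) = 4 ^ n * (real n / exp 1) ^ (2 * n)"
      by (simp add: power_mult power_mult_distrib power_divide)
    also have "fact n ^ 2 * (sqrt 2 * sqrt (real n) * (4 ^ n * (real n / exp 1) ^ (2 * n)))
        / (real n * (real n / exp 1) ^ (2 * n) * fact (2 * n))
        = fact n ^ 2 * sqrt 2 * sqrt (real n) * 4 ^ n / (real n * fact (2 * n))"
      using elim by (simp add: field_simps)
    also have "\<dots> = sqrt 2 * (fact (n - 1) * sqrt (real n) / pochhammer (1/2) n)"
      using elim pp unfolding p f by (simp add: field_simps power2_eq_square)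
    also have "\<dots> = sqrt 2 * Gamma_series' (1/2) n"
      using e by (simp add: Gamma_series'_def)
    finally show ?case .
  qed
  then have "(\<lambda>n. a n ^ 2 / a (2 * n)) \<longlonglongrightarrow> c \<longleftrightarrow>
      (\<lambda>n. sqrt 2 * Gamma_series' (1/2) n) \<longlonglongrightarrow> c" for c
    by (rule tendsto_cong)
  ultimately have "K ^ 2 / K = sqrt 2 * sqrt pi"
    using LIMSEQ_unique by blast
  then have K_eq: "K = sqrt (2 * pi)"
    using K by (simp add: power2_eq_square real_sqrt_mult)
  have "(\<lambda>n. a n / K) \<longlonglongrightarrow> K / K"
    using K by (intro tendsto_intros aK) auto
  then have "(\<lambda>n. a n / K) \<longlonglongrightarrow> 1"
    using K by simp
  moreover have "eventually (\<lambda>n. a n / K =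
      fact n / (sqrt (2 * pi * real n) * (real n / exp 1) ^ n)) sequentially"
    using eventually_gt_at_top[of 0]
    by eventually_elim (simp add: a_eq K_eq real_sqrt_mult)
  ultimately show ?thesis
    by (rule Lim_transform_eventually)
qed

section \<open>Convergence and nonvanishing of the Weierstrass product\<close>

text \<open>The left side is the tail of the logarithm series from the cubic term on, dominated by a
  geometric series.\<close>

lemma Ln_approx_quadratic:
  fixes z :: complex
  assumes "norm z < 1"
  shows "norm (Ln (1 + z) - z + z ^ 2 / 2) \<le> norm z ^ 3 / (1 - norm z)"
proof -
  let ?g = "\<lambda>n. - ((- z) ^ n) / of_nat n"
  have "?g sums Ln (1 + z)"
    using Ln_series'[OF assms] .
  \<comment> \<open>The terms split off are the linear one, the quadratic one and that of index 0,
    which is 0 because division by 0 gives 0.\<close>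
  from sums_split_initial_segment[OF this, of 3]
  have *: "(\<lambda>n. ?g (n + 3)) sums (Ln (1 + z) - z + z ^ 2 / 2)"
    by (simp add: eval_nat_numeral algebra_simps)
  have geo: "(\<lambda>n. norm z ^ 3 * norm z ^ n) sums (norm z ^ 3 * (1 / (1 - norm z)))"
    using assms by (intro sums_mult geometric_sums) auto
  have le: "norm (?g (n + 3)) \<le> norm z ^ 3 * norm z ^ n" for n
  proof -
    have "norm (?g (n + 3)) = norm z ^ (n + 3) / real (n + 3)"
      by (simp only: norm_divide norm_minus_cancel norm_power norm_of_nat)
    also have "\<dots> \<le> norm z ^ (n + 3) / 1"
      by (intro divide_left_mono) auto
    finally show ?thesis
      by (simp add: power_add mult_ac)
  qed
  have "norm (suminf (\<lambda>n. ?g (n + 3))) \<le> suminf (\<lambda>n. norm z ^ 3 * norm z ^ n)"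
    using geo le by (intro norm_suminf_le) (auto dest: sums_summable)
  then show ?thesis
    using * geo by (simp only: sums_unique[symmetric]) simp
qed

text \<open>Principal-branch logarithm of the Weierstrass factor of index m = \<open>Suc k\<close>:
  its exponential is that factor whenever 1 + z/m is nonzero.\<close>

definition barnes_log_term :: "complex \<Rightarrow> nat \<Rightarrow> complex" where
  "barnes_log_term z k =
     of_nat (Suc k) * Ln (1 + z / of_nat (Suc k)) - z + z\<^sup>2 / (2 * of_nat (Suc k))"

text \<open>Each term is m times the remainder of \<open>Ln_approx_quadratic\<close> at z/m, hence
  at most 2 |z|^3 / m^2 once m >= 2 |z|.\<close>

lemma summable_barnes_log_term: "summable (barnes_log_term z)"
proof (rule summable_comparison_test_ev)
  have "eventually (\<lambda>k. real (Suc k) \<ge> 2 * norm z) sequentially"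
    by real_asymp
  then show "eventually (\<lambda>k. norm (barnes_log_term z k) \<le> 2 * norm z ^ 3 * (1 / real (Suc k) ^ 2)) sequentially"
  proof eventually_elim
    case (elim k)
    let ?m = "of_nat (Suc k) :: complex"
    have half: "norm (z / ?m) \<le> 1/2"
      using elim by (simp add: norm_divide field_simps del: of_nat_Suc)
    have m: "?m \<noteq> 0"
      by (simp del: of_nat_Suc)
    then have "barnes_log_term z k = ?m * (Ln (1 + z / ?m) - z / ?m + (z / ?m) ^ 2 / 2)"
      by (simp add: barnes_log_term_def field_simps power2_eq_square del: of_nat_Suc)
    also have "norm \<dots> = real (Suc k) * norm (Ln (1 + z / ?m) - z / ?m + (z / ?m) ^ 2 / 2)"
      by (simp only: norm_mult norm_of_nat)
    also have "\<dots> \<le> real (Suc k) * (norm (z / ?m) ^ 3 / (1 - norm (z / ?m)))"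
      using half by (intro mult_left_mono Ln_approx_quadratic) auto
    also have "\<dots> \<le> real (Suc k) * (norm (z / ?m) ^ 3 / (1 / 2))"
      using half by (intro mult_left_mono divide_left_mono) auto
    also have "\<dots> = 2 * norm z ^ 3 * (1 / real (Suc k) ^ 2)"
      by (simp add: norm_divide power_divide field_simps eval_nat_numeral del: of_nat_Suc)
    finally show ?case .
  qed
  have "summable (\<lambda>k. 1 / real (Suc k) ^ 2)"
    using inverse_power_summable[of 2, where 'a = real]
    by (subst summable_Suc_iff) (simp add: inverse_eq_divide)
  then show "summable (\<lambda>k. 2 * norm z ^ 3 * (1 / real (Suc k) ^ 2))"
    by (rule summable_mult)
qed

text \<open>A by-product of the summability: \<open>barnes_log_term z k\<close> and z^2 / (2m) tend
  to 0, so m Ln(1 + z/m) tends to z.\<close>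

lemma tendsto_complex_exp_limit: "(\<lambda>n. (1 + z / of_nat n) ^ n) \<longlonglongrightarrow> exp (z :: complex)"
proof -
  have "(\<lambda>k. barnes_log_term z k + z - z\<^sup>2 / 2 * (1 / of_nat (Suc k))) \<longlonglongrightarrow> 0 + z - z\<^sup>2 / 2 * 0"
    by (intro tendsto_intros summable_LIMSEQ_zero summable_barnes_log_term
          LIMSEQ_Suc[OF lim_1_over_n])
  then have "(\<lambda>k. of_nat (Suc k) * Ln (1 + z / of_nat (Suc k))) \<longlonglongrightarrow> z"
    by (simp add: barnes_log_term_def del: of_nat_Suc)
  then have "(\<lambda>n. of_nat n * Ln (1 + z / of_nat n)) \<longlonglongrightarrow> z"
    by (rule LIMSEQ_imp_Suc)
  then have "(\<lambda>n. exp (of_nat n * Ln (1 + z / of_nat n))) \<longlonglongrightarrow> exp z"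
    by (rule tendsto_exp)
  moreover have "eventually (\<lambda>n. real n > norm z) sequentially"
    by real_asymp
  then have "eventually (\<lambda>n. exp (of_nat n * Ln (1 + z / of_nat n)) = (1 + z / of_nat n) ^ n) sequentially"
  proof eventually_elim
    case (elim n)
    have "1 + z / of_nat n \<noteq> 0"
    proof
      assume "1 + z / of_nat n = 0"
      then have "norm (z / of_nat n) = norm (- 1 :: complex)"
        by (metis add_eq_0_iff)
      with elim show False
        by (simp add: norm_divide split: if_splits)
    qed
    then show ?case
      by (simp add: exp_of_nat_mult)
  qed
  ultimately show ?thesis
    by (rule Lim_transform_eventually)
qed

definition barnes_factor :: "complex \<Rightarrow> nat \<Rightarrow> complex" where
  "barnes_factor z k =
     (1 + z / of_nat (Suc k)) ^ Suc k * exp (- z + z\<^sup>2 / (2 * of_nat (Suc k)))"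

lemma barnes_factor_base_nonzero:
  fixes z :: complex
  assumes "z + 1 \<notin> \<int>\<^sub>\<le>\<^sub>0"
  shows "1 + z / of_nat (Suc k) \<noteq> 0"
proof
  assume "1 + z / of_nat (Suc k) = 0"
  then have "z / of_nat (Suc k) = - 1"
    by (metis add_eq_0_iff)
  then have "z = - of_nat (Suc k)"
    by (simp add: divide_eq_eq del: of_nat_Suc)
  then have "z + 1 = - of_nat k"
    by simp
  with assms show False
    by simp
qed

text \<open>Away from the zeros every factor is the exponential of its
  \<open>barnes_log_term\<close>, and these are summable.\<close>

lemma convergent_prod_barnes_factor:
  assumes "z + 1 \<notin> \<int>\<^sub>\<le>\<^sub>0"
  shows "convergent_prod (barnes_factor z)"
proof -
  have "barnes_factor z k = exp (barnes_log_term z k)" for k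
    unfolding barnes_factor_def barnes_log_term_def diff_conv_add_uminus add.assoc exp_add[of "_ * _"]
      exp_of_nat_mult exp_Ln[OF barnes_factor_base_nonzero[OF assms]] ..
  then have "barnes_factor z = (\<lambda>k. exp (barnes_log_term z k))"
    by blast
  then show ?thesis
    using sums_imp_has_prod_exp[OF summable_sums[OF summable_barnes_log_term[of z]]]
    by (auto simp: convergent_prod_def o_def)
qed

lemma barnes_factor_nonzero: "z + 1 \<notin> \<int>\<^sub>\<le>\<^sub>0 \<Longrightarrow> barnes_factor z k \<noteq> 0"
  using barnes_factor_base_nonzero[of z k] by (simp add: barnes_factor_def del: of_nat_Suc)

lemma barnes_G_altdef:
  "barnes_G s = of_real (2 * pi) powr ((s - 1) / 2)
     * exp (- ((s - 1) * s + of_real euler_mascheroni * (s - 1)\<^sup>2) / 2) * prodinf (barnes_factor (s - 1))"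
  by (simp add: barnes_G_def Let_def barnes_factor_def[abs_def])

lemma barnes_G_nonzero:
  assumes "s \<notin> \<int>\<^sub>\<le>\<^sub>0"
  shows "barnes_G s \<noteq> 0"
proof -
  have "prodinf (barnes_factor (s - 1)) \<noteq> 0"
    using assms by (intro prodinf_nonzero convergent_prod_barnes_factor barnes_factor_nonzero) auto
  then show ?thesis
    by (simp add: barnes_G_altdef)
qed

lemma barnes_G_1: "barnes_G 1 = 1"
  by (simp add: barnes_G_altdef barnes_factor_def[abs_def])

section \<open>The functional equation from the partial products\<close>

text \<open>The powers of \<open>1 + s / m\<close> and \<open>1 + (s - 1) / m\<close> telescope against the Pochhammer symbol.\<close>
lemma prod_barnes_factor_step:
  "(\<Prod>k<N. barnes_factor s k) * pochhammer s N =
     (\<Prod>k<N. barnes_factor (s - 1) k) * (s + of_nat N) ^ N * exp (- of_nat N + (s - 1/2) * harm N)"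
proof (induction N)
  case (Suc N)
  define m :: complex where "m = of_nat (Suc N)"
  have m: "m \<noteq> 0"
    unfolding m_def by (simp del: of_nat_Suc)
  have Nm: "of_nat N = m - 1"
    by (simp add: m_def)
  \<comment> \<open>The exponents of the two factors of index m differ by -1 + (s - 1/2)/m, which
    accumulates to -N + (s - 1/2) \<open>harm N\<close>.\<close>
  have e: "- s + s\<^sup>2 / (2 * m) = (- (s - 1) + (s - 1)\<^sup>2 / (2 * m)) + (- 1 + (s - 1/2) / m)"
    using m by (simp add: field_simps power2_eq_square)
  have b1: "(1 + s / m) ^ Suc N = (s + m) ^ Suc N / m ^ Suc N"
    unfolding power_divide[symmetric] using m by (simp add: add_divide_distrib add.commute)
  \<comment> \<open>The numerator s + N is also the one at s for the previous index; this is what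
    telescopes.\<close>
  have "1 + (s - 1) / m = (s + of_nat N) / m"
    using m by (simp add: Nm field_simps)
  then have b2: "(1 + (s - 1) / m) ^ Suc N = (s + of_nat N) ^ Suc N / m ^ Suc N"
    by (simp only: power_divide)
  have "(\<Prod>k<Suc N. barnes_factor s k) * pochhammer s (Suc N)
     = ((\<Prod>k<N. barnes_factor s k) * pochhammer s N) * (barnes_factor s N * (s + of_nat N))"
    by (simp add: pochhammer_Suc mult_ac)
  also have "\<dots> = (\<Prod>k<N. barnes_factor (s - 1) k) * (s + of_nat N) ^ N
       * exp (- of_nat N + (s - 1/2) * harm N) * (barnes_factor s N * (s + of_nat N))"
    by (simp only: Suc.IH)
  also have "barnes_factor s N * (s + of_nat N) * (s + of_nat N) ^ N
      = barnes_factor (s - 1) N * (s + m) ^ Suc N * exp (- 1 + (s - 1/2) / m)"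
    unfolding barnes_factor_def m_def[symmetric] e b1 b2 by (subst exp_add) simp
  then have "(\<Prod>k<N. barnes_factor (s - 1) k) * (s + of_nat N) ^ N
       * exp (- of_nat N + (s - 1/2) * harm N) * (barnes_factor s N * (s + of_nat N))
    = (\<Prod>k<N. barnes_factor (s - 1) k) * exp (- of_nat N + (s - 1/2) * harm N) *
       (barnes_factor (s - 1) N * (s + m) ^ Suc N * exp (- 1 + (s - 1/2) / m))"
    by (simp add: mult_ac)
  also have "\<dots> = (\<Prod>k<Suc N. barnes_factor (s - 1) k) * (s + m) ^ Suc N *
       (exp (- of_nat N + (s - 1/2) * harm N) * exp (- 1 + (s - 1/2) / m))"
    by (simp add: mult_ac)
  also have "exp (- of_nat N + (s - 1/2) * harm N) * exp (- 1 + (s - 1/2) / m)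
     = exp (- of_nat (Suc N) + (s - 1/2) * harm (Suc N))"
  proof -
    have "harm (Suc N) = harm N + 1 / m"
      by (simp add: harm_Suc m_def inverse_eq_divide)
    then have "- of_nat N + (s - 1/2) * harm N + (- 1 + (s - 1/2) / m)
      = - of_nat (Suc N) + (s - 1/2) * harm (Suc N)"
      by (simp add: distrib_left)
    then show ?thesis
      by (simp only: exp_add[symmetric])
  qed
  finally show ?case
    by (simp only: m_def)
qed (simp add: harm_def)

text \<open>By \<open>prod_barnes_factor_step\<close> this is the quotient of the partial products
  at s and s - 1. It splits into Euler's sequence for Gamma s, (1 + s/N)^N, exp((s -
  1/2)(\<open>harm N\<close> - ln N)) and the reciprocal Stirling quotient over sqrt(2 pi).\<close>

lemma barnes_ratio_limit:
  fixes s :: complex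
  assumes s: "s \<notin> \<int>\<^sub>\<le>\<^sub>0"
  shows "(\<lambda>N. (s + of_nat N) ^ N * exp (- of_nat N + (s - 1/2) * harm N) / pochhammer s N)
     \<longlonglongrightarrow> Gamma s * exp s * exp ((s - 1/2) * of_real euler_mascheroni) / of_real (sqrt (2 * pi))"
proof -
  define q where "q n = fact n / (sqrt (2 * pi * real n) * (real n / exp 1) ^ n)" for n
  have q: "(\<lambda>n. complex_of_real (inverse (q n))) \<longlonglongrightarrow> of_real (inverse 1)"
    unfolding q_def by (intro tendsto_intros stirling) auto
  have "(\<lambda>N. Gamma_series' s N * (1 + s / of_nat N) ^ N
         * exp ((s - 1/2) * of_real (harm N - ln (real N))) * of_real (inverse (q N)) / of_real (sqrt (2 * pi)))
     \<longlonglongrightarrow> Gamma s * exp s * exp ((s - 1/2) * of_real euler_mascheroni) * of_real (inverse 1) / of_real (sqrt (2 * pi))"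
    by (intro tendsto_intros Gamma_series'_LIMSEQ tendsto_complex_exp_limit q
          euler_mascheroni_LIMSEQ) auto
  moreover have "eventually (\<lambda>N. Gamma_series' s N * (1 + s / of_nat N) ^ N
         * exp ((s - 1/2) * of_real (harm N - ln (real N))) * of_real (inverse (q N)) / of_real (sqrt (2 * pi))
      = (s + of_nat N) ^ N * exp (- of_nat N + (s - 1/2) * harm N) / pochhammer s N) sequentially"
    using eventually_gt_at_top[of 0]
  proof eventually_elim
    case (elim N)
    define l where "l = complex_of_real (ln (real N))"
    have N: "complex_of_nat N = exp l"
      using elim unfolding l_def exp_of_real by simp
    have sqrtN: "complex_of_real (sqrt (real N)) = exp (l / 2)"
    proof -
      have "sqrt (real N) = exp (ln (real N) / 2)"
        using elim by (simp add: powr_half_sqrt[symmetric] powr_def)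
      then show ?thesis
        by (simp add: l_def flip: exp_of_real)
    qed
    have f: "fact N = exp l * (fact (N - 1) :: complex)"
      using elim by (simp add: fact_reduce N)
    have pw: "(real N / exp 1) ^ N = real N ^ N * exp (- real N)"
      using exp_of_nat_mult[of N "1 :: real"] by (simp add: power_divide exp_minus inverse_eq_divide)
    have "inverse (q N) = sqrt (2 * pi) * sqrt (real N) * (real N ^ N * exp (- real N)) / fact N"
      by (simp add: q_def real_sqrt_mult pw)
    then have iq: "complex_of_real (inverse (q N)) / of_real (sqrt (2 * pi))
       = exp (l / 2) * (of_nat N ^ N * exp (- of_nat N)) / (exp l * fact (N - 1))"
      unfolding f[symmetric] sqrtN[symmetric] by (simp flip: exp_of_real)
    have b: "(1 + s / of_nat N) ^ N = (s + of_nat N) ^ N / of_nat N ^ N"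
      using elim by (simp add: field_simps flip: power_divide)
    \<comment> \<open>The powers of N combine to N^s N^(1/2 - s) N^(1/2) = N, which cancels the N in
      N! = N (N-1)!.\<close>
    have ex: "exp (s * l) * exp ((s - 1/2) * (harm N - l)) * exp (l / 2) * exp (- of_nat N)
       = exp l * exp (- of_nat N + (s - 1/2) * harm N)"
      unfolding exp_add[symmetric] by (simp add: field_simps)
    have "Gamma_series' s N * (1 + s / of_nat N) ^ N
         * exp ((s - 1/2) * of_real (harm N - ln (real N))) * of_real (inverse (q N)) / of_real (sqrt (2 * pi))
      = Gamma_series' s N * (1 + s / of_nat N) ^ N
         * exp ((s - 1/2) * of_real (harm N - ln (real N))) * (of_real (inverse (q N)) / of_real (sqrt (2 * pi)))"
      by simp
    also have "\<dots> = (s + of_nat N) ^ N * (exp (s * l) * exp ((s - 1/2) * (harm N - l)) * exp (l / 2) * exp (- of_nat N))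
         / (exp l * pochhammer s N)"
      unfolding iq b Gamma_series'_def using elim
      by (simp add: l_def[symmetric] of_real_harm divide_simps)
    also have "\<dots> = (s + of_nat N) ^ N * exp (- of_nat N + (s - 1/2) * harm N) / pochhammer s N"
      unfolding ex by simp
    finally show ?case .
  qed
  ultimately show ?thesis
    by (simp add: Lim_transform_eventually)
qed

text \<open>The products contribute the factor \<open>R\<close>. Its sqrt(2 pi) cancels against the
  power of 2 pi, and its exponentials account exactly for the change of the quadratic
  exponent.\<close>

lemma barnes_G_plus_1:
  assumes s: "s \<notin> \<int>\<^sub>\<le>\<^sub>0"
  shows "barnes_G (s + 1) = Gamma s * barnes_G s"
proof -
  have s1: "s + 1 \<notin> \<int>\<^sub>\<le>\<^sub>0"
    using s plus_one_in_nonpos_Ints_imp by blast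
  define P where "P z = prodinf (barnes_factor z)" for z
  have P: "(\<lambda>N. \<Prod>k<N. barnes_factor z k) \<longlonglongrightarrow> P z" if "z + 1 \<notin> \<int>\<^sub>\<le>\<^sub>0" for z
    unfolding P_def using that convergent_prod_barnes_factor has_prod_imp_tendsto' by blast
  have poch: "pochhammer s N \<noteq> 0" for N
    using s by (auto dest: pochhammer_eq_0_imp_nonpos_Int)
  define R where "R = Gamma s * exp s * exp ((s - 1/2) * of_real euler_mascheroni) / of_real (sqrt (2 * pi))"
  have "(\<lambda>N. (\<Prod>k<N. barnes_factor (s - 1) k) *
        ((s + of_nat N) ^ N * exp (- of_nat N + (s - 1/2) * harm N) / pochhammer s N)) \<longlonglongrightarrow> P (s - 1) * R"
    unfolding R_def using s by (intro tendsto_mult P barnes_ratio_limit) auto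
  also have "(\<lambda>N. (\<Prod>k<N. barnes_factor (s - 1) k) *
        ((s + of_nat N) ^ N * exp (- of_nat N + (s - 1/2) * harm N) / pochhammer s N))
     = (\<lambda>N. \<Prod>k<N. barnes_factor s k)"
    using prod_barnes_factor_step[of s] poch by (auto simp: fun_eq_iff field_simps)
  finally have PR: "P s = P (s - 1) * R"
    using P[OF s1] LIMSEQ_unique by blast
  define g :: complex where "g = of_real euler_mascheroni"
  have sq: "of_real (2 * pi) powr (s / 2) = of_real (2 * pi) powr ((s - 1) / 2) * complex_of_real (sqrt (2 * pi))"
  proof -
    have "complex_of_real (sqrt (2 * pi)) = of_real (2 * pi) powr (1 / 2)"
      using powr_of_real[of "2 * pi" "1/2"] by (simp add: powr_half_sqrt)
    then show ?thesis
      by (simp add: diff_divide_distrib flip: powr_add)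
  qed
  have ex: "exp (- (s * (s + 1) + g * s\<^sup>2) / 2) * (exp s * exp ((s - 1/2) * g))
     = exp (- ((s - 1) * s + g * (s - 1)\<^sup>2) / 2)"
    unfolding exp_add[symmetric]
    by (intro arg_cong[of _ _ exp]) (simp add: field_simps power2_eq_square)
  have "barnes_G (s + 1) = of_real (2 * pi) powr (s / 2) * exp (- (s * (s + 1) + g * s\<^sup>2) / 2) * P s"
    by (simp add: barnes_G_altdef P_def g_def)
  also have "\<dots> = Gamma s * (of_real (2 * pi) powr ((s - 1) / 2) *
       (exp (- (s * (s + 1) + g * s\<^sup>2) / 2) * (exp s * exp ((s - 1/2) * g))) * P (s - 1))"
    unfolding sq PR R_def g_def[symmetric] by simp
  also have "\<dots> = Gamma s * barnes_G s"
    unfolding ex by (simp add: barnes_G_altdef P_def g_def)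
  finally show ?thesis .
qed

lemma prod_Gamma_barnes_G:
  assumes "z \<notin> \<int>\<^sub>\<le>\<^sub>0"
  shows "(\<Prod>k\<le>n. Gamma (z + of_nat k)) = barnes_G (z + of_nat n + 1) / barnes_G z"
proof (induction n)
  case 0
  then show ?case
    using barnes_G_plus_1[OF assms] barnes_G_nonzero[OF assms] by simp
next
  case (Suc n)
  have "z + of_nat (Suc n) \<notin> \<int>\<^sub>\<le>\<^sub>0"
    using assms by (metis add_diff_cancel_right' nonpos_Ints_diff_Nats of_nat_in_Nats)
  from barnes_G_plus_1[OF this] Suc show ?case
    by (simp add: add_ac)
qed

subsection \<open>The determinant and the inverse\<close>

text \<open>The case z = 1 of the Gamma product, as k! = Gamma(k + 1) and G(1) = 1.\<close>

lemma prod_fact_barnes_G: "(\<Prod>k\<le>n. fact k) = barnes_G (of_nat n + 2)"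
proof -
  have "(1 :: complex) \<notin> \<int>\<^sub>\<le>\<^sub>0"
    by simp
  from prod_Gamma_barnes_G[OF this, of n] show ?thesis
    by (simp add: barnes_G_1 Gamma_fact add_ac)
qed

theorem theorem2p2:
  fixes \<alpha> :: real and n :: nat
  assumes "\<alpha> > -1"
  shows "complex_of_real (Determinant.det (moment_mat \<alpha> n)) =
           barnes_G (of_nat n + 2) * barnes_G (of_real \<alpha> + of_nat n + 2)
           / (barnes_G (of_real \<alpha> + 1) * Gamma (of_real \<alpha> + 1) ^ (n + 1))
         \<and> Matrix.inverts_mat (moment_mat \<alpha> n) (moment_inv_mat \<alpha> n)
         \<and> Matrix.inverts_mat (moment_inv_mat \<alpha> n) (moment_mat \<alpha> n)"
proof (intro conjI)
  define a :: complex where "a = of_real \<alpha> + 1"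
  have a: "a \<notin> \<int>\<^sub>\<le>\<^sub>0"
  proof
    assume "a \<in> \<int>\<^sub>\<le>\<^sub>0"
    then have "complex_of_real (\<alpha> + 1) \<in> \<int>\<^sub>\<le>\<^sub>0"
      by (simp add: a_def)
    then have "\<alpha> + 1 \<le> 0"
      unfolding of_real_in_nonpos_Ints_iff by (rule nonpos_Ints_nonpos)
    with assms show False
      by simp
  qed
  have "complex_of_real (Determinant.det (moment_mat \<alpha> n)) = (\<Prod>k\<le>n. fact k * pochhammer a k)"
    using pochhammer_of_real[of "\<alpha> + 1", where 'a = complex]
    by (simp add: det_moment_mat[OF assms] a_def)
  \<comment> \<open>Each of the n + 1 symbols (a)_k = Gamma(a + k) / Gamma(a) contributes one power
    of Gamma(a) to the denominator.\<close>
  also have "\<dots> = (\<Prod>k\<le>n. fact k) * (\<Prod>k\<le>n. Gamma (a + of_nat k)) / Gamma a ^ (n + 1)"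
    by (simp add: pochhammer_Gamma[OF a] prod.distrib prod_dividef)
  also have "\<dots> = barnes_G (of_nat n + 2) * barnes_G (of_real \<alpha> + of_nat n + 2)
           / (barnes_G (of_real \<alpha> + 1) * Gamma (of_real \<alpha> + 1) ^ (n + 1))"
    unfolding prod_fact_barnes_G prod_Gamma_barnes_G[OF a] by (simp add: a_def add_ac)
  finally show "complex_of_real (Determinant.det (moment_mat \<alpha> n)) = \<dots>" .
  have carr: "moment_mat \<alpha> n \<in> carrier_mat (n + 1) (n + 1)"
    "moment_inv_mat \<alpha> n \<in> carrier_mat (n + 1) (n + 1)"
    by (simp_all add: moment_mat_def moment_inv_mat_def)
  note inv = moment_mat_mult_inv[OF assms, of n]
  show "inverts_mat (moment_mat \<alpha> n) (moment_inv_mat \<alpha> n)"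
    using inv carr by (simp add: inverts_mat_def)
  show "inverts_mat (moment_inv_mat \<alpha> n) (moment_mat \<alpha> n)"
    using mat_mult_left_right_inverse[OF carr inv] carr by (simp add: inverts_mat_def)
qed

end
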